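(* Let $A,B$ be finite alphabets, let $F$ be a cellular automaton on $A^{\mathbb{Z}^2}$ and $G$ a cellular automaton on $B^{\mathbb{Z}^2}$, and let $\mu$ and $\nu$ be bi-invariant probability measures for $F$ and $G$ respectively ($\mu$ is invariant under $F$ and all shifts of $A^{\mathbb{Z}^2}$; $\nu$ is invariant under $G$ and all shifts of $B^{\mathbb{Z}^2}$). If there exists a measurable map $\varphi:A^{\mathbb{Z}^2}\to B^{\mathbb{Z}^2}$ such that (1) $\varphi$ commutes with every shift, (2) $\varphi\circ F=G\circ\varphi$, and (3) $\varphi\mu=\nu$ (push-forward), then $$ER_\mu(A^{\mathbb{Z}^2},F)\ge ER_\nu(B^{\mathbb{Z}^2},G).$$ In particular, entropy rate is an invariant for the class of shift-commuting isomorphisms: if $(A^{\mathbb{Z}^2},F,\mu)$ and $(B^{\mathbb{Z}^2},G,\nu)$ are isomorphic via an isomorphism commuting with all shifts, then $ER_\mu(A^{\mathbb{Z}^2},F)=ER_\nu(B^{\mathbb{Z}^2},G)$.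
   Context: $A^{\mathbb{Z}^2}$ carries the product of discrete topologies and its Borel $\sigma$-algebra (similarly for $B$). The shifts are $\sigma^v(x)_u=x_{u+v}$, $u,v\in\mathbb{Z}^2$. Let $E_n=\{(i,j)\in\mathbb{Z}^2: -n\le i,j\le n\}$. A cellular automaton (CA) $F$ is a continuous self-map of $A^{\mathbb{Z}^2}$ commuting with all shifts; equivalently there are $r\in\mathbb{N}$ and $f:A^{E_r}\to A$ with $F(x)_z=f\big((x_{z+u})_{u\in E_r}\big)$ for all $z$; such an $r$ is called the radius of $F$. For $n\ge r$, $E'_n=E_n\setminus E_{n-r}$. For a finite measurable partition $\mathcal{P}$, $\mathcal{P}'_n=\bigvee_{v\in E'_n}\sigma^v(\mathcal{P})$. $h_\mu(\mathcal{P},F)=\lim_{N}\frac1N H_\mu(\bigvee_{i=0}^{N-1}F^{-i}\mathcal{P})$ with $H_\mu$ the Shannon entropy of a partition. For an $F$-invariant probability measure $\mu$, $ER_\mu(\mathcal{P},F)=\limsup_{n\to\infty}\frac1n h_\mu(\mathcal{P}'_n,F)$, and $ER_\mu(A^{\mathbb{Z}^2},F)=\sup_{\mathcal{P}}ER_\mu(\mathcal{P},F)$ over all finite measurable partitions. An isomorphism between $(X,\mathcal{A},\mu,T)$ and $(X',\mathcal{A}',\mu',T')$ is a bijective, bi-measurable, measure-preserving map $\varphi$ between sets $E\in\mathcal{A}$, $E'\in\mathcal{A}'$ of full measure with $\varphi\circ T=T'\circ\varphi$ on $E$. *)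

theory Defs
  imports "HOL-Probability.Probability"
begin

type_synonym 'a config = "int \<times> int \<Rightarrow> 'a"

definition shift_map :: "int \<times> int \<Rightarrow> 'a config \<Rightarrow> 'a config" where
  "shift_map v x = (\<lambda>u. x (u + v))"

definition square :: "nat \<Rightarrow> (int \<times> int) set" where
  "square n = {- int n..int n} \<times> {- int n..int n}"

text \<open>Only used asymptotically in \<open>n\<close>, so the truncated subtraction for \<open>n < r\<close> is harmless.\<close>

definition frame :: "nat \<Rightarrow> nat \<Rightarrow> (int \<times> int) set" where
  "frame r n = square n - square (n - r)"

text \<open>
  For \<open>'a\<close> of class \<open>discrete_topology\<close>, the function space carries the product of the discrete
  topologies, which is the topology underlying both \<open>continuous_on\<close> and \<open>borel\<close> below.
\<close>

definition cellular_automaton ::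
  "('a::{finite,discrete_topology} config \<Rightarrow> 'a config) \<Rightarrow> bool" where
  "cellular_automaton F \<longleftrightarrow>
     continuous_on UNIV F \<and> (\<forall>v. F \<circ> shift_map v = shift_map v \<circ> F)"

text \<open>
  A radius is not unique: every number above a radius is again one. The local rule lives on
  \<open>'a\<close>-valued functions on the square, represented as extensional functions.
\<close>

definition is_radius :: "('a config \<Rightarrow> 'a config) \<Rightarrow> nat \<Rightarrow> bool" where
  "is_radius F r \<longleftrightarrow>
     (\<exists>f. \<forall>x z. F x z = f (restrict (\<lambda>u. x (z + u)) (square r)))"

definition invariant_under :: "'x measure \<Rightarrow> ('x \<Rightarrow> 'x) \<Rightarrow> bool" where
  "invariant_under M T \<longleftrightarrow> T \<in> measurable M M \<and> distr M M T = M"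

definition bi_invariant :: "'a config measure \<Rightarrow> ('a config \<Rightarrow> 'a config) \<Rightarrow> bool" where
  "bi_invariant M F \<longleftrightarrow> invariant_under M F \<and> (\<forall>v. invariant_under M (shift_map v))"

definition finite_measurable_partition :: "'x measure \<Rightarrow> 'x set set \<Rightarrow> bool" where
  "finite_measurable_partition M P \<longleftrightarrow>
     finite P \<and> partition_on (space M) P \<and> P \<subseteq> sets M"

definition partition_entropy :: "'x measure \<Rightarrow> 'x set set \<Rightarrow> real" where
  "partition_entropy M P = - (\<Sum>C\<in>P. measure M C * ln (measure M C))"

definition pullback_partition :: "('x \<Rightarrow> 'x) \<Rightarrow> 'x set set \<Rightarrow> 'x set set" where
  "pullback_partition T P = (\<lambda>C. T -` C) ` P - {{}}"

text \<open>
  \<open>common_refinement\<close> takes a set of partitions; repeated members of the family do not affect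
  the join. The join of the empty family is the trivial partition \<open>{UNIV}\<close>.
\<close>

definition dynamical_entropy :: "'x measure \<Rightarrow> 'x set set \<Rightarrow> ('x \<Rightarrow> 'x) \<Rightarrow> real" where
  "dynamical_entropy M P T =
     lim (\<lambda>N. partition_entropy M
                (common_refinement ((\<lambda>i. pullback_partition (T ^^ i) P) ` {..<N})) / real N)"

definition frame_partition :: "nat \<Rightarrow> nat \<Rightarrow> 'a config set set \<Rightarrow> 'a config set set" where
  "frame_partition r n P = common_refinement ((\<lambda>v. (`) (shift_map v) ` P) ` frame r n)"

definition entropy_rate_partition ::
  "'a config measure \<Rightarrow> nat \<Rightarrow> 'a config set set \<Rightarrow> ('a config \<Rightarrow> 'a config) \<Rightarrow> ereal" where
  "entropy_rate_partition M r P F =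
     limsup (\<lambda>n. ereal (dynamical_entropy M (frame_partition r n P) F / real n))"

text \<open>Here \<open>r\<close> is meant to be a radius of \<open>F\<close>.\<close>

definition entropy_rate ::
  "'a config measure \<Rightarrow> nat \<Rightarrow> ('a config \<Rightarrow> 'a config) \<Rightarrow> ereal" where
  "entropy_rate M r F =
     (SUP P\<in>{P. finite_measurable_partition M P}. entropy_rate_partition M r P F)"

text \<open>
  The values of \<open>\<phi>\<close> outside \<open>E\<close> are irrelevant, so commutation is only required at points of
  \<open>E\<close> whose image under the transformation lies in \<open>E\<close>. For \<open>T\<close> preserving the probability
  measure this is almost every point; if \<open>T\<close> maps \<open>E\<close> into itself, it is every point of \<open>E\<close>.
\<close>

definition intertwines_on :: "'x set \<Rightarrow> ('x \<Rightarrow> 'y) \<Rightarrow> ('x \<Rightarrow> 'x) \<Rightarrow> ('y \<Rightarrow> 'y) \<Rightarrow> bool" where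
  "intertwines_on E \<phi> T T' \<longleftrightarrow> (\<forall>x\<in>E. T x \<in> E \<longrightarrow> \<phi> (T x) = T' (\<phi> x))"

definition isomorphism_on ::
  "'x measure \<Rightarrow> ('x \<Rightarrow> 'x) \<Rightarrow> 'y measure \<Rightarrow> ('y \<Rightarrow> 'y) \<Rightarrow>
   'x set \<Rightarrow> 'y set \<Rightarrow> ('x \<Rightarrow> 'y) \<Rightarrow> bool" where
  "isomorphism_on M T M' T' E E' \<phi> \<longleftrightarrow>
     E \<in> sets M \<and> emeasure M E = emeasure M (space M) \<and>
     E' \<in> sets M' \<and> emeasure M' E' = emeasure M' (space M') \<and>
     bij_betw \<phi> E E' \<and>
     \<phi> \<in> measurable (restrict_space M E) (restrict_space M' E') \<and>
     the_inv_into E \<phi> \<in> measurable (restrict_space M' E') (restrict_space M E) \<and>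
     distr (restrict_space M E) (restrict_space M' E') \<phi> = restrict_space M' E' \<and>
     intertwines_on E \<phi> T T'"

end

theory Submission
  imports Defs
begin

text \<open>
  A factor map \<open>\<phi>\<close> pulls a partition \<open>P\<close> of the factor back to a partition \<open>Q\<close> of the extension
  without changing any of the entropies involved, almost sure commutation being enough. The frames
  of the two automata may have different thicknesses \<open>r\<close> and \<open>s\<close>. For \<open>r \<ge> 1\<close> every point of the
  frame of thickness \<open>s\<close> is within distance \<open>s\<close> of the frame of thickness \<open>r\<close>, so replacing \<open>Q\<close> by
  its join over the square of radius \<open>s\<close> compensates the difference. For \<open>r = 0\<close> the automaton acts
  cell by cell on a finite alphabet, hence is eventually periodic and has entropy zero. An
  isomorphism yields, after an arbitrary extension to null sets, a factor map in each direction.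

  A partition is handled as the set of fibers of a labelling of the points; joins then correspond
  to tuples of labellings, for which monotonicity and subadditivity of entropy are available.
\<close>

section \<open>Partitions as fibers of labellings\<close>

text \<open>Classes are indexed by points and not by labels, so a label that is never attained
  contributes no empty class.\<close>

definition fibers :: "('x \<Rightarrow> 'c) \<Rightarrow> 'x set set" where
  "fibers X = range (\<lambda>x. X -` {X x})"

definition itinerary :: "('x \<Rightarrow> 'x) \<Rightarrow> ('x \<Rightarrow> 'c) \<Rightarrow> nat \<Rightarrow> 'x \<Rightarrow> nat \<Rightarrow> 'c" where
  "itinerary T X N x = restrict (\<lambda>i. X ((T ^^ i) x)) {..<N}"

text \<open>The minus sign appears because \<open>frame_partition\<close> takes images of classes: a
  point lies in the image of a class under \<open>shift_map v\<close> exactly when its shift by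
  \<open>- v\<close> lies in the class.\<close>

definition translates :: "(int \<times> int) set \<Rightarrow> ('a config \<Rightarrow> 'c) \<Rightarrow> 'a config \<Rightarrow> int \<times> int \<Rightarrow> 'c" where
  "translates S X x = restrict (\<lambda>v. X (shift_map (- v) x)) S"

text \<open>Lets an arbitrary partition enter as a labelling: the label of a point is the set of
  classes containing it, which is a singleton.\<close>

lemma fibers_classes:
  assumes "partition_on UNIV P"
  shows "fibers (\<lambda>x. {C \<in> P. x \<in> C}) = P"
proof -
  have uniq: "{D \<in> P. x \<in> D} = {C}" if "C \<in> P" "x \<in> C" for C x
    using assms that by (auto simp: partition_on_def disjoint_def)
  have fib: "(\<lambda>x. {D \<in> P. x \<in> D}) -` {{D \<in> P. x \<in> D}} = C" if "C \<in> P" "x \<in> C" for C x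
    unfolding uniq[OF that] using uniq[OF that(1)] by blast
  show ?thesis
  proof (intro equalityI subsetI)
    fix C assume "C \<in> fibers (\<lambda>x. {C \<in> P. x \<in> C})"
    then obtain x where x: "C = (\<lambda>x. {D \<in> P. x \<in> D}) -` {{D \<in> P. x \<in> D}}"
      by (auto simp: fibers_def)
    obtain D where "D \<in> P" "x \<in> D" using assms by (auto simp: partition_on_def)
    with fib x show "C \<in> P" by simp
  next
    fix C assume C: "C \<in> P"
    then have "C \<noteq> {}" using assms by (auto simp: partition_on_def)
    then obtain x where "x \<in> C" by blast
    with fib[OF C] show "C \<in> fibers (\<lambda>x. {C \<in> P. x \<in> C})"
      unfolding fibers_def by (metis (no_types, lifting) rangeI)
  qed
qed

lemma partition_on_fibers: "partition_on UNIV (fibers X)"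
  by (auto simp: partition_on_def fibers_def disjoint_def)

lemma pullback_partition_fibers: "pullback_partition T (fibers X) = fibers (\<lambda>x. X (T x))"
proof (intro equalityI subsetI)
  fix C assume "C \<in> pullback_partition T (fibers X)"
  then obtain x where C: "C = T -` X -` {X x}" "C \<noteq> {}"
    by (auto simp: pullback_partition_def fibers_def)
  then obtain y where "X (T y) = X x" by auto
  with C have "C = (\<lambda>x. X (T x)) -` {X (T y)}" by auto
  then show "C \<in> fibers (\<lambda>x. X (T x))" by (auto simp: fibers_def)
next
  fix C assume "C \<in> fibers (\<lambda>x. X (T x))"
  then obtain x where C: "C = T -` X -` {X (T x)}" by (auto simp: fibers_def)
  moreover have "x \<in> C" by (simp add: C)
  ultimately show "C \<in> pullback_partition T (fibers X)"
    by (auto simp: pullback_partition_def fibers_def)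
qed

lemma restrict_eq_iff: "restrict f I = restrict g I \<longleftrightarrow> (\<forall>i\<in>I. f i = g i)"
  by (metis restrict_apply' restrict_ext)

text \<open>A class of the join is determined by any one of its points \<open>x\<close>: it is the
  intersection of the classes through \<open>x\<close>, hence a fiber of the tuple of
  labels.\<close>

lemma common_refinement_fibers:
  "common_refinement ((\<lambda>i. fibers (X i)) ` I) = fibers (\<lambda>x. restrict (\<lambda>i. X i x) I)"
proof -
  let ?\<P> = "(\<lambda>i. fibers (X i)) ` I"
  have fib: "(\<lambda>x. restrict (\<lambda>i. X i x) I) -` {restrict (\<lambda>i. X i x) I} = (\<Inter>i\<in>I. X i -` {X i x})" for x
    by (auto simp: restrict_eq_iff)
  show ?thesis
  proof (intro equalityI subsetI)
    fix C assume "C \<in> common_refinement ?\<P>"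
    then obtain f x where f: "\<And>P. P \<in> ?\<P> \<Longrightarrow> f P \<in> P" and C: "C = \<Inter> (f ` ?\<P>)" "x \<in> C"
      by (auto simp: common_refinement)
    have "f (fibers (X i)) = X i -` {X i x}" if "i \<in> I" for i
    proof -
      have "f (fibers (X i)) \<in> fibers (X i)" "x \<in> f (fibers (X i))"
        using f C that by auto
      then show ?thesis by (auto simp: fibers_def)
    qed
    then have "C = (\<Inter>i\<in>I. X i -` {X i x})" using C by auto
    then show "C \<in> fibers (\<lambda>x. restrict (\<lambda>i. X i x) I)"
      unfolding fibers_def by (intro image_eqI[of _ _ x]) (simp_all add: fib)
  next
    fix C assume "C \<in> fibers (\<lambda>x. restrict (\<lambda>i. X i x) I)"
    then obtain x where C: "C = (\<Inter>i\<in>I. X i -` {X i x})"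
      using fib by (auto simp: fibers_def)
    \<comment> \<open>The choice goes by partition and not by index, so it is well defined when
      several indices yield the same partition. The union merely extracts the unique class through
      \<open>x\<close>.\<close>
    define f where "f P = \<Union>{D \<in> P. x \<in> D}" for P
    have f: "f (fibers (X i)) = X i -` {X i x}" for i
      by (auto simp: f_def fibers_def)
    then have "f \<in> (\<Pi> P\<in>?\<P>. P)"
      by (auto simp: fibers_def)
    moreover have "C = \<Inter> (f ` ?\<P>)" using C f by auto
    moreover have "C \<noteq> {}" using C by auto
    ultimately show "C \<in> common_refinement ?\<P>"
      unfolding common_refinement by blast
  qed
qed

lemma shift_map_inverse [simp]: "shift_map v (shift_map (- v) x) = x" "shift_map (- v) (shift_map v x) = x"
  by (auto simp: shift_map_def)

lemma shift_map_add: "shift_map u (shift_map v x) = shift_map (u + v) x"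
  by (auto simp: shift_map_def add_ac)

lemma shift_image_fibers: "(`) (shift_map v) ` fibers X = fibers (\<lambda>x. X (shift_map (- v) x))"
proof -
  have img: "shift_map v ` A = shift_map (- v) -` A" for A :: "'a config set"
    by (auto simp: image_iff intro: shift_map_inverse(1)[symmetric] bexI[rotated])
  have surj: "\<exists>y. shift_map (- v) y = x" for x :: "'a config"
    by (metis shift_map_inverse(2))
  show ?thesis
  proof (intro equalityI subsetI)
    fix C assume "C \<in> (`) (shift_map v) ` fibers X"
    then obtain x where "C = shift_map (- v) -` X -` {X x}"
      unfolding fibers_def img image_image by auto
    moreover obtain y where "shift_map (- v) y = x" using surj by blast
    ultimately show "C \<in> fibers (\<lambda>x. X (shift_map (- v) x))"
      by (auto simp: fibers_def vimage_def)
  next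
    fix C assume "C \<in> fibers (\<lambda>x. X (shift_map (- v) x))"
    then show "C \<in> (`) (shift_map v) ` fibers X"
      unfolding fibers_def img image_image by (auto simp: vimage_def)
  qed
qed

lemma frame_partition_fibers: "frame_partition r n (fibers X) = fibers (translates (frame r n) X)"
  by (simp add: frame_partition_def shift_image_fibers common_refinement_fibers translates_def[abs_def])

lemma dynamical_entropy_fibers:
  "dynamical_entropy M (fibers X) T = lim (\<lambda>N. partition_entropy M (fibers (itinerary T X N)) / real N)"
  by (simp add: dynamical_entropy_def pullback_partition_fibers common_refinement_fibers itinerary_def[abs_def])

section \<open>Measurability of tuples and compositions of labellings\<close>

lemma simple_function_restrict:
  assumes "finite I" and X: "\<And>i. i \<in> I \<Longrightarrow> simple_function M (X i)"
  shows "simple_function M (\<lambda>x. restrict (\<lambda>i. X i x) I)"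
  unfolding simple_function_def
proof (intro conjI ballI)
  have "(\<lambda>x. restrict (\<lambda>i. X i x) I) ` space M \<subseteq> (\<Pi>\<^sub>E i\<in>I. X i ` space M)" by auto
  moreover have "finite (\<Pi>\<^sub>E i\<in>I. X i ` space M)"
    using assms by (intro finite_PiE) (auto dest: simple_functionD)
  ultimately show "finite ((\<lambda>x. restrict (\<lambda>i. X i x) I) ` space M)"
    by (rule finite_subset)
  fix g assume "g \<in> (\<lambda>x. restrict (\<lambda>i. X i x) I) ` space M"
  then have "(\<lambda>x. restrict (\<lambda>i. X i x) I) -` {g} \<inter> space M = {x\<in>space M. \<forall>i\<in>I. X i x = g i}"
    by (auto simp: restrict_eq_iff)
  also have "\<dots> \<in> sets M"
  proof (rule sets.sets_Collect_finite_All[OF _ \<open>finite I\<close>])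
    fix i assume "i \<in> I"
    then have "X i -` {g i} \<inter> space M \<in> sets M" using X by (auto dest: simple_functionD)
    moreover have "X i -` {g i} \<inter> space M = {x\<in>space M. X i x = g i}" by auto
    ultimately show "{x\<in>space M. X i x = g i} \<in> sets M" by simp
  qed
  finally show "(\<lambda>x. restrict (\<lambda>i. X i x) I) -` {g} \<inter> space M \<in> sets M" .
qed

lemma simple_function_comp_measurable:
  assumes "simple_function N Y" and "\<phi> \<in> measurable M N"
  shows "simple_function M (\<lambda>x. Y (\<phi> x))"
  unfolding simple_function_def
proof (intro conjI ballI)
  have "(\<lambda>x. Y (\<phi> x)) ` space M \<subseteq> Y ` space N"
    using assms(2) by (auto dest: measurable_space)
  then show "finite ((\<lambda>x. Y (\<phi> x)) ` space M)"
    using assms(1) by (auto dest: simple_functionD intro: finite_subset)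
  fix c
  have "(\<lambda>x. Y (\<phi> x)) -` {c} \<inter> space M = \<phi> -` (Y -` {c} \<inter> space N) \<inter> space M"
    using assms(2) by (auto dest: measurable_space)
  then show "(\<lambda>x. Y (\<phi> x)) -` {c} \<inter> space M \<in> sets M"
    using measurable_sets[OF assms(2) simple_functionD(2)[OF assms(1)]] by simp
qed

lemma simple_function_translates:
  assumes "simple_function M X" and "finite S" and "\<And>v. shift_map v \<in> measurable M M"
  shows "simple_function M (translates S X)"
  unfolding translates_def[abs_def]
  by (intro simple_function_restrict simple_function_comp_measurable[OF assms(1)] assms)

lemma measurable_funpow:
  assumes "T \<in> measurable M M"
  shows "(T ^^ i) \<in> measurable M M"
  by (induction i) (auto simp: id_def intro: measurable_compose[OF _ assms])

lemma simple_function_itinerary: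
  assumes "simple_function M X" and "T \<in> measurable M M"
  shows "simple_function M (itinerary T X N)"
  unfolding itinerary_def[abs_def]
  by (intro simple_function_restrict simple_function_comp_measurable[OF assms(1)]
        measurable_funpow assms(2)) auto

section \<open>Shannon entropy\<close>

text \<open>Unattained labels have empty fibers and contribute 0, so labellings with different
  ranges can be compared term by term over a common label set.\<close>

lemma partition_entropy_fibers_sum:
  assumes "finite S" and "range X \<subseteq> S"
  shows "partition_entropy M (fibers X) = - (\<Sum>c\<in>S. measure M (X -` {c}) * ln (measure M (X -` {c})))"
proof -
  have fin: "finite (range X)" using assms by (rule finite_subset[rotated])
  have fibers: "fibers X = (\<lambda>c. X -` {c}) ` range X" by (auto simp: fibers_def)
  have inj: "inj_on (\<lambda>c. X -` {c}) (range X)" by (auto simp: inj_on_def)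
  have "partition_entropy M (fibers X) = - (\<Sum>c\<in>range X. measure M (X -` {c}) * ln (measure M (X -` {c})))"
    unfolding partition_entropy_def fibers by (subst sum.reindex[OF inj]) simp
  also have "(\<Sum>c\<in>range X. measure M (X -` {c}) * ln (measure M (X -` {c}))) =
      (\<Sum>c\<in>S. measure M (X -` {c}) * ln (measure M (X -` {c})))"
  proof (rule sum.mono_neutral_left[OF assms], intro ballI)
    fix c assume "c \<in> S - range X"
    then have "X -` {c} = {}" by auto
    then show "measure M (X -` {c}) * ln (measure M (X -` {c})) = 0" by simp
  qed
  finally show ?thesis .
qed

text \<open>Entropy depends only on the distribution of the label, and \<open>X\<close> under
  \<open>M\<close> is distributed as \<open>Y\<close> under \<open>N\<close>; null sets do not
  affect this.\<close>

lemma partition_entropy_fibers_transfer: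
  assumes M: "prob_space M" "space M = UNIV" "space N = UNIV"
    and \<phi>: "\<phi> \<in> measurable M N" "distr M N \<phi> = N"
    and X: "simple_function M X" and Y: "simple_function N Y"
    and ae: "AE x in M. X x = Y (\<phi> x)"
  shows "partition_entropy M (fibers X) = partition_entropy N (fibers Y)"
proof -
  interpret prob_space M by fact
  let ?S = "range X \<union> range Y"
  have fin: "finite ?S" using X Y M by (auto dest: simple_functionD)
  have "measure M (X -` {c}) = measure N (Y -` {c})" for c
  proof -
    have XM: "X -` {c} \<in> sets M" using simple_functionD(2)[OF X, of "{c}"] M by simp
    have YM: "Y -` {c} \<in> sets N" using simple_functionD(2)[OF Y, of "{c}"] M by simp
    have "measure M (X -` {c}) = measure M (\<phi> -` (Y -` {c}) \<inter> space M)"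
      using ae XM measurable_sets[OF \<phi>(1) YM] by (intro measure_eq_AE) (auto simp: M)
    also have "\<dots> = measure (distr M N \<phi>) (Y -` {c})"
      using \<phi>(1) YM by (rule measure_distr[symmetric])
    finally show ?thesis by (simp add: \<phi>(2))
  qed
  then show ?thesis
    by (subst (1 2) partition_entropy_fibers_sum[OF fin]) auto
qed

text \<open>The base \<open>exp 1\<close> turns the logarithm into \<open>ln\<close>, which gives
  access to the data processing inequality and the chain rule.\<close>

lemma partition_entropy_eq_entropy:
  assumes "prob_space M" "space M = UNIV" "simple_function M X"
  shows "partition_entropy M (fibers X) = prob_space.entropy M (exp 1) (count_space (X ` space M)) X"
proof -
  interpret information_space M "exp 1"
    by (intro information_space.intro information_space_axioms.intro assms) simp
  have "finite (range X)" using assms by (auto dest: simple_functionD)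
  from partition_entropy_fibers_sum[OF this order_refl] show ?thesis
    by (subst entropy_simple_distributed[OF simple_distributedI[OF assms(3) measure_nonneg refl]])
       (simp add: assms(2) log_ln)
qed

lemma partition_entropy_mono:
  assumes M: "prob_space M" "space M = UNIV" and X: "simple_function M X" and Y: "simple_function M Y"
    and fac: "\<And>x y. Y x = Y y \<Longrightarrow> X x = X y"
  shows "partition_entropy M (fibers X) \<le> partition_entropy M (fibers Y)"
proof -
  interpret information_space M "exp 1"
    by (intro information_space.intro information_space_axioms.intro assms) simp
  \<comment> \<open>\<open>inv Y\<close> picks a representative of each label, and by
    \<open>fac\<close> it has the right value of \<open>X\<close>; so \<open>X\<close> is a function
    of \<open>Y\<close>.\<close>
  have "X = (\<lambda>c. X (inv Y c)) \<circ> Y"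
    by (auto simp: fun_eq_iff intro!: fac simp: f_inv_into_f)
  then show ?thesis
    using entropy_data_processing[OF Y, of "\<lambda>c. X (inv Y c)"]
    by (simp add: partition_entropy_eq_entropy M X Y)
qed

lemma partition_entropy_subadditive:
  assumes M: "prob_space M" "space M = UNIV" and X: "simple_function M X" and Y: "simple_function M Y"
  shows "partition_entropy M (fibers (\<lambda>x. (X x, Y x))) \<le> partition_entropy M (fibers X) + partition_entropy M (fibers Y)"
proof -
  interpret information_space M "exp 1"
    by (intro information_space.intro information_space_axioms.intro assms) simp
  \<comment> \<open>H(X,Y) = H(X) + H(Y|X), and conditioning does not increase H(Y).\<close>
  show ?thesis
    using entropy_chain_rule[OF X Y] conditional_entropy_less_eq_entropy[OF Y X]
    by (simp add: partition_entropy_eq_entropy M X Y simple_function_Pair)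
qed

lemma partition_entropy_nonneg:
  assumes "prob_space M"
  shows "partition_entropy M P \<ge> 0"
proof -
  interpret prob_space M by fact
  have "measure M C * ln (measure M C) \<le> 0" for C
    by (cases "measure M C = 0") (auto simp: mult_nonneg_nonpos zero_less_measure_iff less_le)
  then show ?thesis by (simp add: partition_entropy_def sum_nonpos)
qed

section \<open>Dynamical entropy\<close>

lemma subadditive_multiple_le:
  fixes a :: "nat \<Rightarrow> real"
  assumes "\<And>m n. a (m + n) \<le> a m + a n"
  shows "a (q * m + t) \<le> real q * a m + a t"
proof (induction q)
  case (Suc q)
  have "a (Suc q * m + t) = a (m + (q * m + t))" by (simp add: add_ac)
  also have "\<dots> \<le> a m + a (q * m + t)" by (rule assms)
  finally show ?case using Suc.IH by (simp add: algebra_simps)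
qed simp

text \<open>Fekete's lemma: the limit is the infimum of the quotients. The upper bound comes from
  dividing \<open>n\<close> with remainder by an \<open>m\<close> whose quotient is close to the
  infimum.\<close>

lemma fekete_convergent:
  fixes a :: "nat \<Rightarrow> real"
  assumes nonneg: "\<And>n. 0 \<le> a n" and sub: "\<And>m n. a (m + n) \<le> a m + a n"
  shows "convergent (\<lambda>n. a n / real n)"
proof -
  define L where "L = Inf ((\<lambda>n. a n / real n) ` {1..})"
  have bdd: "bdd_below ((\<lambda>n. a n / real n) ` {1..})"
    by (rule bdd_belowI[of _ 0]) (auto simp: nonneg)
  have "(\<lambda>n. a n / real n) \<longlonglongrightarrow> L"
  proof (rule order_tendstoI)
    fix l assume l: "l < L"
    have "l < a n / real n" if "n \<ge> 1" for n
    proof -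
      have "L \<le> a n / real n" unfolding L_def by (rule cInf_lower[OF _ bdd]) (use that in auto)
      with l show ?thesis by simp
    qed
    then show "eventually (\<lambda>n. l < a n / real n) sequentially"
      by (auto simp: eventually_sequentially)
  next
    fix u assume "L < u"
    then obtain m where m: "m \<ge> 1" "a m / real m < u"
      unfolding L_def by (subst (asm) cInf_less_iff[OF _ bdd]) auto
    \<comment> \<open>A bound on \<open>a t\<close> for every remainder \<open>t < m\<close>,
      independent of \<open>n\<close>; it is one because all terms are nonnegative.\<close>
    define C where "C = (\<Sum>t<m. a t)"
    have le: "a n / real n \<le> a m / real m + C / real n" if "n \<ge> 1" for n
    proof -
      have "a n = a (n div m * m + n mod m)" by simp
      also have "\<dots> \<le> real (n div m) * a m + a (n mod m)"
        by (rule subadditive_multiple_le[OF sub])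
      also have "a (n mod m) \<le> C"
        unfolding C_def using m by (intro member_le_sum) (auto simp: nonneg)
      also have "real (n div m) * a m \<le> (real n / real m) * a m"
        by (intro mult_right_mono nonneg) (rule of_nat_div_le_of_nat)
      finally have "a n \<le> (real n / real m) * a m + C" by simp
      then have "a n / real n \<le> ((real n / real m) * a m + C) / real n"
        by (rule divide_right_mono) simp
      also have "\<dots> = a m / real m + C / real n"
        using that by (simp add: field_simps)
      finally show ?thesis .
    qed
    have "(\<lambda>n. a m / real m + C / real n) \<longlonglongrightarrow> a m / real m + 0"
      by (intro tendsto_intros lim_const_over_n)
    then have "eventually (\<lambda>n. a m / real m + C / real n < u) sequentially"
      using m(2) by (auto dest: order_tendstoD(2))
    then show "eventually (\<lambda>n. a n / real n < u) sequentially"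
      using eventually_ge_at_top[of 1] by eventually_elim (use le in force)
  qed
  then show ?thesis by (rule convergentI)
qed

lemma invariant_under_funpow:
  assumes "invariant_under M T"
  shows "invariant_under M (T ^^ i)"
proof (induction i)
  case 0
  then show ?case by (simp add: invariant_under_def distr_id id_def)
next
  case (Suc i)
  moreover from this have "distr M M (T \<circ> (T ^^ i)) = distr (distr M M (T ^^ i)) M T"
    using assms by (intro distr_distr[symmetric]) (auto simp: invariant_under_def)
  ultimately show ?case
    using assms by (auto simp: invariant_under_def comp_def intro: measurable_compose)
qed

lemma AE_invariant_under:
  assumes "invariant_under M T" and "AE x in M. P x"
  shows "AE x in M. P (T x)"
  using AE_distrD[of T M M P] assms unfolding invariant_under_def by metis

text \<open>Makes the \<open>lim\<close> in \<open>dynamical_entropy\<close> a genuine limit. An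
  itinerary of length \<open>m + n\<close> splits into its first \<open>m\<close> labels and an
  itinerary of length \<open>n\<close> started at time \<open>m\<close>; by invariance the latter
  has the entropy of one started at time 0, whence subadditivity.\<close>

lemma convergent_itinerary_entropy:
  assumes M: "prob_space M" "space M = UNIV" and X: "simple_function M X"
    and T: "invariant_under M T"
  shows "convergent (\<lambda>N. partition_entropy M (fibers (itinerary T X N)) / real N)"
proof (rule fekete_convergent)
  have Tm: "T \<in> measurable M M" using T by (simp add: invariant_under_def)
  note sf = simple_function_itinerary[OF X Tm]
  fix m n
  have Tpow: "T ^^ m \<in> measurable M M" "distr M M (T ^^ m) = M"
    using invariant_under_funpow[OF T] by (auto simp: invariant_under_def)
  note sf' = simple_function_comp_measurable[OF sf Tpow(1)]
  have "partition_entropy M (fibers (itinerary T X (m + n)))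
      \<le> partition_entropy M (fibers (\<lambda>x. (itinerary T X m x, itinerary T X n ((T ^^ m) x))))"
  proof (rule partition_entropy_mono[OF M sf simple_function_Pair[OF sf sf']])
    fix x y
    assume "(itinerary T X m x, itinerary T X n ((T ^^ m) x)) = (itinerary T X m y, itinerary T X n ((T ^^ m) y))"
    then have 1: "\<And>i. i < m \<Longrightarrow> X ((T ^^ i) x) = X ((T ^^ i) y)"
      and 2: "\<And>i. i < n \<Longrightarrow> X ((T ^^ (i + m)) x) = X ((T ^^ (i + m)) y)"
      by (auto simp: itinerary_def restrict_eq_iff funpow_add)
    have "X ((T ^^ i) x) = X ((T ^^ i) y)" if "i < m + n" for i
      using 1[of i] 2[of "i - m"] that by (cases "i < m") auto
    then show "itinerary T X (m + n) x = itinerary T X (m + n) y"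
      by (auto simp: itinerary_def restrict_eq_iff)
  qed
  also have "\<dots> \<le> partition_entropy M (fibers (itinerary T X m))
      + partition_entropy M (fibers (\<lambda>x. itinerary T X n ((T ^^ m) x)))"
    by (rule partition_entropy_subadditive[OF M sf sf'])
  also have "partition_entropy M (fibers (\<lambda>x. itinerary T X n ((T ^^ m) x))) =
      partition_entropy M (fibers (itinerary T X n))"
    by (rule partition_entropy_fibers_transfer[OF M M(2) Tpow sf' sf]) simp
  finally show "partition_entropy M (fibers (itinerary T X (m + n)))
    \<le> partition_entropy M (fibers (itinerary T X m)) + partition_entropy M (fibers (itinerary T X n))" .
qed (rule partition_entropy_nonneg[OF M(1)])

text \<open>Itineraries of \<open>Y\<close> determine those of \<open>X\<close>, and as both limits
  exist the inequality at finite length passes to them.\<close>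

lemma dynamical_entropy_mono:
  assumes M: "prob_space M" "space M = UNIV" and X: "simple_function M X" and Y: "simple_function M Y"
    and T: "invariant_under M T" and fac: "\<And>x y. Y x = Y y \<Longrightarrow> X x = X y"
  shows "dynamical_entropy M (fibers X) T \<le> dynamical_entropy M (fibers Y) T"
  unfolding dynamical_entropy_fibers
proof (rule LIMSEQ_le)
  show "(\<lambda>N. partition_entropy M (fibers (itinerary T X N)) / real N) \<longlonglongrightarrow>
      lim (\<lambda>N. partition_entropy M (fibers (itinerary T X N)) / real N)"
    using convergent_itinerary_entropy[OF M X T] by (simp add: convergent_LIMSEQ_iff)
  show "(\<lambda>N. partition_entropy M (fibers (itinerary T Y N)) / real N) \<longlonglongrightarrow>
      lim (\<lambda>N. partition_entropy M (fibers (itinerary T Y N)) / real N)"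
    using convergent_itinerary_entropy[OF M Y T] by (simp add: convergent_LIMSEQ_iff)
  have Tm: "T \<in> measurable M M" using T by (simp add: invariant_under_def)
  have "partition_entropy M (fibers (itinerary T X N)) \<le> partition_entropy M (fibers (itinerary T Y N))" for N
    by (rule partition_entropy_mono[OF M simple_function_itinerary[OF X Tm] simple_function_itinerary[OF Y Tm]])
       (auto simp: itinerary_def restrict_eq_iff intro: fac)
  then show "\<exists>N. \<forall>n\<ge>N. partition_entropy M (fibers (itinerary T X n)) / real n
      \<le> partition_entropy M (fibers (itinerary T Y n)) / real n"
    by (intro exI[of _ 0] allI impI divide_right_mono) auto
qed

section \<open>Independence of the thickness of the frame\<close>

lemma finite_square: "finite (square n)"
  by (simp add: square_def)

lemma finite_frame: "finite (frame r n)"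
  by (simp add: frame_def finite_square)

text \<open>Some coordinate of \<open>v\<close> exceeds \<open>n - s\<close> in absolute value.
  Moving it out to \<open>n\<close> or \<open>- n\<close> costs at most \<open>s\<close> and reaches
  the boundary of \<open>square n\<close>, which lies in the frame of thickness \<open>r\<close> as
  soon as \<open>r\<close> and \<open>n\<close> are positive.\<close>

lemma frame_thickening:
  assumes "r \<ge> 1" and "n \<ge> 1" and v: "v \<in> frame s n"
  obtains u w where "u \<in> frame r n" and "w \<in> square s" and "v = u + w"
proof -
  obtain i j where ij: "v = (i, j)" by (cases v)
  have bounds: "\<bar>i\<bar> \<le> int n" "\<bar>j\<bar> \<le> int n"
    using v by (auto simp: ij frame_def square_def)
  consider "i > int (n - s)" | "i < - int (n - s)" | "j > int (n - s)" | "j < - int (n - s)"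
    using v by (fastforce simp: ij frame_def square_def)
  then show thesis
  proof cases
    case 1 show thesis
      by (rule that[of "(int n, j)" "(i - int n, 0)"])
         (use 1 assms(1,2) bounds in \<open>auto simp: ij frame_def square_def\<close>)
  next
    case 2 show thesis
      by (rule that[of "(- int n, j)" "(i + int n, 0)"])
         (use 2 assms(1,2) bounds in \<open>auto simp: ij frame_def square_def\<close>)
  next
    case 3 show thesis
      by (rule that[of "(i, int n)" "(0, j - int n)"])
         (use 3 assms(1,2) bounds in \<open>auto simp: ij frame_def square_def\<close>)
  next
    case 4 show thesis
      by (rule that[of "(i, - int n)" "(0, j + int n)"])
         (use 4 assms(1,2) bounds in \<open>auto simp: ij frame_def square_def\<close>)
  qed
qed

lemma funpow_radius_zero:
  fixes F :: "'a::finite config \<Rightarrow> 'a config"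
  assumes "is_radius F 0"
  obtains i j where "i < j" and "F ^^ j = F ^^ i"
proof -
  obtain f where f: "\<And>x z. F x z = f (restrict (\<lambda>u. x (z + u)) (square 0))"
    using assms by (auto simp: is_radius_def)
  \<comment> \<open>With radius 0 each cell sees only itself, so the local rule amounts to a
    self-map \<open>g\<close> of the alphabet.\<close>
  define g where "g a = f (restrict (\<lambda>u. a) {0})" for a
  have sq: "square 0 = {0}" by (auto simp: square_def zero_prod_def)
  have "F x z = g (x z)" for x z
    unfolding f sq g_def by (rule arg_cong[of _ _ f]) (auto simp: restrict_def)
  then have "F x = g \<circ> x" for x
    by (auto simp: fun_eq_iff)
  then have pow: "(F ^^ k) x = (g ^^ k) \<circ> x" for k x
    by (induction k) (auto simp: fun_eq_iff)
  \<comment> \<open>A finite alphabet has finitely many self-maps, so the powers of \<open>g\<close>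
    repeat.\<close>
  have "\<not> inj (\<lambda>k. g ^^ k)"
    using finite_imageD[of "\<lambda>k::nat. g ^^ k" UNIV] by auto
  then obtain k l where "k \<noteq> l" "g ^^ k = g ^^ l" by (auto simp: inj_on_def)
  then show thesis
    using that[of k l] that[of l k] pow by (cases "k < l") (auto simp: fun_eq_iff)
qed

text \<open>An exponent \<open>k\<close> \<ge> \<open>j\<close> can be replaced by the smaller
  \<open>k - j + i\<close>; strong induction brings it below \<open>j\<close>.\<close>

lemma funpow_eventually_periodic:
  fixes T :: "'x \<Rightarrow> 'x"
  assumes "i < j" and "T ^^ j = T ^^ i"
  shows "\<exists>l<j. T ^^ k = T ^^ l"
proof (induction k rule: less_induct)
  case (less k)
  show ?case
  proof (cases "k < j")
    case False
    then have "T ^^ k = T ^^ (k - j) \<circ> T ^^ j"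
      by (metis funpow_add le_add_diff_inverse2 not_less)
    also have "\<dots> = T ^^ (k - j + i)" by (simp add: assms funpow_add)
    finally show ?thesis using less.IH[of "k - j + i"] assms(1) False by auto
  qed auto
qed

text \<open>\<open>F\<close> has finitely many distinct powers, so the family of pulled-back
  partitions stops growing at \<open>N = j\<close>, and a constant divided by \<open>N\<close> tends
  to 0.\<close>

lemma dynamical_entropy_radius_zero:
  fixes F :: "'a::finite config \<Rightarrow> 'a config"
  assumes "is_radius F 0"
  shows "dynamical_entropy M P F = 0"
proof -
  obtain i j where ij: "i < j" "F ^^ j = F ^^ i" using funpow_radius_zero[OF assms] .
  let ?Q = "\<lambda>N. (\<lambda>i. pullback_partition (F ^^ i) P) ` {..<N}"
  have "?Q N = ?Q j" if "N \<ge> j" for N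
  proof
    show "?Q N \<subseteq> ?Q j"
    proof
      fix R assume "R \<in> ?Q N"
      then obtain k where "R = pullback_partition (F ^^ k) P" by auto
      moreover obtain l where "l < j" "F ^^ k = F ^^ l"
        using funpow_eventually_periodic[OF ij] by blast
      ultimately show "R \<in> ?Q j" by auto
    qed
    show "?Q j \<subseteq> ?Q N" using that by (intro image_mono) auto
  qed
  then have "eventually (\<lambda>N. partition_entropy M (common_refinement (?Q j)) / real N =
      partition_entropy M (common_refinement (?Q N)) / real N) sequentially"
    unfolding eventually_sequentially by (intro exI[of _ j]) metis
  with lim_const_over_n have "(\<lambda>N. partition_entropy M (common_refinement (?Q N)) / real N) \<longlonglongrightarrow> 0"
    by (rule Lim_transform_eventually)
  then show ?thesis unfolding dynamical_entropy_def by (rule limI)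
qed

lemma entropy_rate_partition_thickness:
  fixes F :: "'a::finite config \<Rightarrow> 'a config"
  assumes M: "prob_space M" "space M = UNIV" and X: "simple_function M X"
    and inv: "bi_invariant M F" and r: "is_radius F r"
  shows "entropy_rate_partition M s (fibers X) F
    \<le> entropy_rate_partition M r (fibers (translates (square s) X)) F"
proof (cases "r = 0")
  case True
  with r show ?thesis by (simp add: entropy_rate_partition_def dynamical_entropy_radius_zero)
next
  case False
  have F: "invariant_under M F" and sh: "\<And>v. shift_map v \<in> measurable M M"
    using inv by (auto simp: bi_invariant_def invariant_under_def)
  note sf = simple_function_translates[OF X finite_square sh]
  have "dynamical_entropy M (frame_partition s n (fibers X)) F
      \<le> dynamical_entropy M (frame_partition r n (fibers (translates (square s) X))) F" if n: "n \<ge> 1" for n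
    unfolding frame_partition_fibers
  proof (rule dynamical_entropy_mono[OF M _ _ F])
    show "simple_function M (translates (frame s n) X)"
      by (rule simple_function_translates[OF X finite_frame sh])
    show "simple_function M (translates (frame r n) (translates (square s) X))"
      by (rule simple_function_translates[OF sf finite_frame sh])
    fix x y
    assume "translates (frame r n) (translates (square s) X) x = translates (frame r n) (translates (square s) X) y"
    \<comment> \<open>Successive translations add up, so the tuples on \<open>frame r n\<close>
      reveal the label of \<open>X\<close> at every sum \<open>u + w\<close>; by
      \<open>frame_thickening\<close> these sums cover \<open>frame s n\<close>.\<close>
    then have eq: "X (shift_map (- w + - u) x) = X (shift_map (- w + - u) y)"
      if "u \<in> frame r n" "w \<in> square s" for u w
      using that by (auto simp: translates_def restrict_eq_iff shift_map_add)
    have "X (shift_map (- v) x) = X (shift_map (- v) y)" if v: "v \<in> frame s n" for v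
    proof -
      obtain u w where "u \<in> frame r n" "w \<in> square s" "v = u + w"
        using frame_thickening[OF _ n v, of r] False by (metis less_one not_less)
      with eq[of u w] show ?thesis by (simp add: add.commute)
    qed
    then show "translates (frame s n) X x = translates (frame s n) X y"
      by (simp add: translates_def restrict_eq_iff)
  qed
  then show ?thesis
    unfolding entropy_rate_partition_def
    by (intro Limsup_mono eventually_sequentiallyI[of 1]) (auto intro: divide_right_mono)
qed

section \<open>Factor maps\<close>

text \<open>Preimages of null sets under \<open>F ^^ i\<close> are null, so commutation persists
  along almost every orbit. Pairs of a time \<open>i\<close> and a shift \<open>v\<close> are
  countable in number, hence one null set serves them all.\<close>

lemma itinerary_translates_factor:
  assumes F: "invariant_under M F"
    and comm: "AE x in M. \<phi> (F x) = G (\<phi> x)"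
    and shift: "\<And>v. AE x in M. \<phi> (shift_map v x) = shift_map v (\<phi> x)"
  shows "AE x in M. itinerary F (translates S (\<lambda>x. Y (\<phi> x))) N x = itinerary G (translates S Y) N (\<phi> x)"
proof -
  have iter: "AE x in M. \<phi> ((F ^^ i) x) = (G ^^ i) (\<phi> x)" for i
  proof (induction i)
    case (Suc i)
    with AE_invariant_under[OF invariant_under_funpow[OF F] comm, of i]
    show ?case by eventually_elim simp
  qed simp
  have "AE x in M. \<phi> (shift_map v ((F ^^ i) x)) = shift_map v ((G ^^ i) (\<phi> x))" for i v
    using iter[of i] AE_invariant_under[OF invariant_under_funpow[OF F, of i] shift[of v]]
    by eventually_elim simp
  then have "AE x in M. \<forall>i v. \<phi> (shift_map v ((F ^^ i) x)) = shift_map v ((G ^^ i) (\<phi> x))"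
    by (simp only: AE_all_countable) simp
  then show ?thesis
    by eventually_elim (simp add: itinerary_def translates_def del: split_paired_All)
qed

text \<open>At each finite length the itinerary labellings correspond almost everywhere through
  \<open>\<phi>\<close>, so their entropies agree, and with them everything derived from
  these.\<close>

lemma entropy_rate_partition_factor:
  assumes M: "prob_space M" "space M = UNIV" "bi_invariant M F"
    and N: "space N = UNIV" "bi_invariant N G"
    and \<phi>: "\<phi> \<in> measurable M N" "distr M N \<phi> = N"
    and comm: "AE x in M. \<phi> (F x) = G (\<phi> x)"
    and shift: "\<And>v. AE x in M. \<phi> (shift_map v x) = shift_map v (\<phi> x)"
    and Y: "simple_function N Y"
  shows "entropy_rate_partition N s (fibers Y) G = entropy_rate_partition M s (fibers (\<lambda>x. Y (\<phi> x))) F"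
proof -
  have F: "invariant_under M F" and Fm: "F \<in> measurable M M" and Gm: "G \<in> measurable N N"
    and shM: "\<And>v. shift_map v \<in> measurable M M" and shN: "\<And>v. shift_map v \<in> measurable N N"
    using M N by (auto simp: bi_invariant_def invariant_under_def)
  note Y\<phi> = simple_function_comp_measurable[OF Y \<phi>(1)]
  have "partition_entropy M (fibers (itinerary F (translates (frame s n) (\<lambda>x. Y (\<phi> x))) k)) =
      partition_entropy N (fibers (itinerary G (translates (frame s n) Y) k))" for n k
    by (intro partition_entropy_fibers_transfer[OF M(1,2) N(1) \<phi>] simple_function_itinerary
        simple_function_translates itinerary_translates_factor Y Y\<phi> finite_frame Fm Gm shM shN F comm shift)
  then show ?thesis
    by (simp add: entropy_rate_partition_def frame_partition_fibers dynamical_entropy_fibers)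
qed

lemma finite_measurable_partition_fibers:
  assumes "space M = UNIV" and "simple_function M X"
  shows "finite_measurable_partition M (fibers X)"
proof -
  have "fibers X = (\<lambda>c. X -` {c}) ` range X" by (auto simp: fibers_def)
  moreover have "X -` {c} \<in> sets M" for c
    using simple_functionD(2)[OF assms(2), of "{c}"] assms(1) by simp
  ultimately have "finite (fibers X)" "fibers X \<subseteq> sets M"
    using simple_functionD(1)[OF assms(2)] assms(1) by auto
  then show ?thesis
    by (simp add: finite_measurable_partition_def partition_on_fibers assms(1))
qed

lemma simple_function_classes:
  assumes "space M = UNIV" and "finite_measurable_partition M P"
  shows "simple_function M (\<lambda>x. {C \<in> P. x \<in> C})"
proof -
  have P: "finite P" "partition_on UNIV P" "P \<subseteq> sets M"
    using assms by (auto simp: finite_measurable_partition_def)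
  have "range (\<lambda>x. {C \<in> P. x \<in> C}) \<subseteq> Pow P" by auto
  then have "finite (range (\<lambda>x. {C \<in> P. x \<in> C}))" using P(1) by (auto intro: finite_subset)
  moreover have "(\<lambda>x. {C \<in> P. x \<in> C}) -` {{C \<in> P. y \<in> C}} \<in> sets M" for y
  proof -
    have "(\<lambda>x. {C \<in> P. x \<in> C}) -` {{C \<in> P. y \<in> C}} \<in> fibers (\<lambda>x. {C \<in> P. x \<in> C})"
      by (auto simp: fibers_def)
    then show ?thesis using fibers_classes[OF P(2)] P(3) by auto
  qed
  ultimately show ?thesis by (auto simp: simple_function_def assms(1))
qed

lemma entropy_rate_factor_le:
  fixes F :: "'a::finite config \<Rightarrow> 'a config" and G :: "'b config \<Rightarrow> 'b config"
  assumes M: "prob_space M" "space M = UNIV" "bi_invariant M F" and r: "is_radius F r"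
    and N: "space N = UNIV" "bi_invariant N G"
    and \<phi>: "\<phi> \<in> measurable M N" "distr M N \<phi> = N"
    and comm: "AE x in M. \<phi> (F x) = G (\<phi> x)"
    and shift: "\<And>v. AE x in M. \<phi> (shift_map v x) = shift_map v (\<phi> x)"
  shows "entropy_rate N s G \<le> entropy_rate M r F"
  unfolding entropy_rate_def[of N]
proof (rule SUP_least)
  fix P assume "P \<in> {P. finite_measurable_partition N P}"
  then have P: "finite_measurable_partition N P" by simp
  define Y where "Y x = {C \<in> P. x \<in> C}" for x
  have Y: "simple_function N Y"
    using simple_function_classes[OF N(1) P] by (simp add: Y_def[abs_def])
  have PY: "P = fibers Y"
    using P N(1) fibers_classes[of P] by (simp add: finite_measurable_partition_def Y_def[abs_def])
  define X where "X x = Y (\<phi> x)" for x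
  have X: "simple_function M X"
    using simple_function_comp_measurable[OF Y \<phi>(1)] by (simp add: X_def[abs_def])
  have "\<And>v. shift_map v \<in> measurable M M"
    using M by (auto simp: bi_invariant_def invariant_under_def)
  \<comment> \<open>The competitor in the supremum for \<open>F\<close>: joining over
    \<open>square s\<close> absorbs the difference between the thicknesses \<open>s\<close> and
    \<open>r\<close>.\<close>
  then have Q: "finite_measurable_partition M (fibers (translates (square s) X))"
    by (intro finite_measurable_partition_fibers M simple_function_translates X finite_square)
  have "entropy_rate_partition N s P G = entropy_rate_partition M s (fibers X) F"
    unfolding PY X_def by (rule entropy_rate_partition_factor[OF M N \<phi> comm shift Y])
  also have "\<dots> \<le> entropy_rate_partition M r (fibers (translates (square s) X)) F"
    by (rule entropy_rate_partition_thickness[OF M(1,2) X M(3) r])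
  also have "\<dots> \<le> entropy_rate M r F"
    unfolding entropy_rate_def by (rule SUP_upper) (simp add: Q)
  finally show "entropy_rate_partition N s P G \<le> entropy_rate M r F" .
qed

section \<open>Factor maps from an isomorphism\<close>

lemma AE_intertwines_on:
  assumes "invariant_under M T" and E: "AE x in M. x \<in> E" and "intertwines_on E \<phi> T T'"
    and eq: "\<And>x. x \<in> E \<Longrightarrow> \<psi> x = \<phi> x"
  shows "AE x in M. \<psi> (T x) = T' (\<psi> x)"
  \<comment> \<open>Commutation is granted where both \<open>x\<close> and \<open>T x\<close> lie in
    \<open>E\<close>; by invariance this is almost everywhere.\<close>
  using E AE_invariant_under[OF assms(1) E]
  by eventually_elim (use assms(3) in \<open>auto simp: intertwines_on_def eq\<close>)

text \<open>With \<open>x = \<psi> y\<close>, almost surely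
  \<open>T' y = T' (\<phi> x) = \<phi> (T x)\<close>, and applying \<open>\<psi>\<close> gives
  \<open>T x\<close>. Almost sure statements on \<open>M\<close> are pulled back to \<open>N\<close>
  along \<open>\<psi>\<close>.\<close>

lemma AE_intertwines_inverse:
  assumes inv: "AE y in N. \<phi> (\<psi> y) = y" and \<psi>: "\<psi> \<in> measurable N M" "distr N M \<psi> = M"
    and T: "invariant_under M T" and left: "AE x in M. \<psi> (\<phi> x) = x"
    and comm: "AE x in M. \<phi> (T x) = T' (\<phi> x)"
  shows "AE y in N. \<psi> (T' y) = T (\<psi> y)"
proof -
  have pull: "AE y in N. P (\<psi> y)" if "AE x in M. P x" for P
    using AE_distrD[OF \<psi>(1), of P] \<psi>(2) that by metis
  show ?thesis
    using inv pull[OF comm] pull[OF AE_invariant_under[OF T left]]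
    by eventually_elim metis
qed

lemma isomorphism_on_factor_maps:
  assumes "prob_space M" "prob_space N" and "space M = UNIV" "space N = UNIV"
    and "isomorphism_on M T N T' E E' \<phi>"
  obtains \<phi>' \<psi> where "\<And>x. x \<in> E \<Longrightarrow> \<phi>' x = \<phi> x" and "AE x in M. x \<in> E"
    and "\<phi>' \<in> measurable M N" "distr M N \<phi>' = N"
    and "\<psi> \<in> measurable N M" "distr N M \<psi> = M"
    and "AE x in M. \<psi> (\<phi>' x) = x" and "AE y in N. \<phi>' (\<psi> y) = y"
proof -
  interpret M: prob_space M by fact
  interpret N: prob_space N by fact
  have E: "E \<in> sets M" "emeasure M E = emeasure M (space M)"
    and E': "E' \<in> sets N" "emeasure N E' = emeasure N (space N)"
    and bij: "bij_betw \<phi> E E'"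
    and m\<phi>: "\<phi> \<in> measurable (restrict_space M E) (restrict_space N E')"
    and minv: "the_inv_into E \<phi> \<in> measurable (restrict_space N E') (restrict_space M E)"
    and d: "distr (restrict_space M E) (restrict_space N E') \<phi> = restrict_space N E'"
    using assms(5) by (auto simp: isomorphism_on_def)
  have aeE: "AE x in M. x \<in> E"
    using E by (simp add: M.AE_in_set_eq_1 measure_def M.emeasure_space_1)
  have aeE': "AE y in N. y \<in> E'"
    using E' by (simp add: N.AE_in_set_eq_1 measure_def N.emeasure_space_1)
  \<comment> \<open>Both maps are made total by a constant value off a set of full measure, which no
    almost sure statement detects.\<close>
  define \<phi>' where "\<phi>' x = (if x \<in> E then \<phi> x else undefined)" for x
  define \<psi> where "\<psi> y = (if y \<in> E' then the_inv_into E \<phi> y else undefined)" for y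
  have m\<phi>': "\<phi>' \<in> measurable M N"
    unfolding \<phi>'_def[abs_def] using m\<phi> E(1) assms(3,4)
    by (subst measurable_If_restrict_space_iff) (auto simp: measurable_restrict_space2_iff)
  have m\<psi>: "\<psi> \<in> measurable N M"
    unfolding \<psi>_def[abs_def] using minv E'(1) assms(3,4)
    by (subst measurable_If_restrict_space_iff) (auto simp: measurable_restrict_space2_iff)
  have left: "\<psi> (\<phi>' x) = x" if "x \<in> E" for x
    using bij that by (auto simp: \<phi>'_def \<psi>_def bij_betw_def the_inv_into_f_f)
  have right: "\<phi>' (\<psi> y) = y" if y: "y \<in> E'" for y
  proof -
    obtain x where "x \<in> E" "y = \<phi>' x"
      using bij y by (auto simp: \<phi>'_def bij_betw_def)
    then show ?thesis by (simp add: left)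
  qed
  have d\<phi>': "distr M N \<phi>' = N"
  proof (rule measure_eqI)
    \<comment> \<open>The hypothesis \<open>d\<close> speaks only of subsets of \<open>E\<close> and
      \<open>E'\<close>, so \<open>A\<close> is cut down to \<open>E'\<close> and its preimage to
      \<open>E\<close>, at no cost in measure.\<close>
    fix A assume "A \<in> sets (distr M N \<phi>')"
    then have A: "A \<in> sets N" by simp
    have AE': "A \<inter> E' \<in> sets (restrict_space N E')"
      using A E'(1) by (auto simp: sets_restrict_space)
    have "emeasure (distr M N \<phi>') A = emeasure M (\<phi>' -` A)"
      using A m\<phi>' by (simp add: emeasure_distr assms(3))
    also have "\<dots> = emeasure M (\<phi>' -` A \<inter> E)"
      using aeE measurable_sets[OF m\<phi>' A] E(1) by (intro emeasure_eq_AE) (auto simp: assms(3))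
    also have "\<phi>' -` A \<inter> E = \<phi> -` (A \<inter> E') \<inter> E"
      using bij by (auto simp: \<phi>'_def bij_betw_def)
    also have "emeasure M \<dots> = emeasure (restrict_space M E) \<dots>"
      using E(1) by (intro emeasure_restrict_space[symmetric]) auto
    also have "\<dots> = emeasure (restrict_space N E') (A \<inter> E')"
      using m\<phi> AE' by (subst d[symmetric], subst emeasure_distr) (auto simp: space_restrict_space assms(3))
    also have "\<dots> = emeasure N (A \<inter> E')"
      using E'(1) by (intro emeasure_restrict_space) auto
    also have "\<dots> = emeasure N A"
      using aeE' A E'(1) by (intro emeasure_eq_AE) auto
    finally show "emeasure (distr M N \<phi>') A = emeasure N A" .
  qed simp
  \<comment> \<open>Since \<open>N\<close> is the image of \<open>M\<close> under
    \<open>\<phi>'\<close>, its image under \<open>\<psi>\<close> is that of \<open>M\<close> under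
    a map equal to the identity almost everywhere.\<close>
  have "distr N M \<psi> = distr (distr M N \<phi>') M \<psi>" by (simp add: d\<phi>')
  also have "\<dots> = distr M M (\<psi> \<circ> \<phi>')" by (rule distr_distr[OF m\<psi> m\<phi>'])
  also have "\<dots> = distr M M (\<lambda>x. x)"
    using aeE measurable_comp[OF m\<phi>' m\<psi>] by (intro distr_cong_AE) (auto simp: left)
  also have "\<dots> = M" by (rule distr_id)
  finally have d\<psi>: "distr N M \<psi> = M" .
  show thesis
  proof (rule that[of \<phi>' \<psi>])
    show "AE x in M. \<psi> (\<phi>' x) = x" using aeE by eventually_elim (rule left)
    show "AE y in N. \<phi>' (\<psi> y) = y" using aeE' by eventually_elim (rule right)
    show "\<phi>' x = \<phi> x" if "x \<in> E" for x using that by (simp add: \<phi>'_def)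
  qed (fact aeE m\<phi>' d\<phi>' m\<psi> d\<psi>)+
qed

theorem proposition3:
  fixes F :: "'a::{finite,discrete_topology} config \<Rightarrow> 'a config"
    and G :: "'b::{finite,discrete_topology} config \<Rightarrow> 'b config"
    and \<mu> :: "'a config measure" and \<nu> :: "'b config measure"
    and r s :: nat
  assumes "cellular_automaton F" and "is_radius F r"
    and "cellular_automaton G" and "is_radius G s"
    and "prob_space \<mu>" and "sets \<mu> = sets borel" and "bi_invariant \<mu> F"
    and "prob_space \<nu>" and "sets \<nu> = sets borel" and "bi_invariant \<nu> G"
  shows "((\<exists>\<phi> \<in> measurable \<mu> \<nu>.
             (\<forall>v. \<phi> \<circ> shift_map v = shift_map v \<circ> \<phi>) \<and> \<phi> \<circ> F = G \<circ> \<phi> \<and> distr \<mu> \<nu> \<phi> = \<nu>)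
           \<longrightarrow> entropy_rate \<mu> r F \<ge> entropy_rate \<nu> s G)
       \<and> ((\<exists>\<phi> E E'. isomorphism_on \<mu> F \<nu> G E E' \<phi> \<and>
                     (\<forall>v. intertwines_on E \<phi> (shift_map v) (shift_map v)))
           \<longrightarrow> entropy_rate \<mu> r F = entropy_rate \<nu> s G)"
proof (intro conjI impI; elim bexE exE conjE)
  have sp: "space \<mu> = UNIV" "space \<nu> = UNIV"
    using assms(6,9)[THEN sets_eq_imp_space_eq] by simp_all
  note \<mu> = assms(5) sp(1) assms(7) and \<nu> = assms(8) sp(2) assms(10)
  {
    fix \<phi>
    assume "\<phi> \<in> measurable \<mu> \<nu>" "distr \<mu> \<nu> \<phi> = \<nu>" and "\<phi> \<circ> F = G \<circ> \<phi>"
      and "\<forall>v. \<phi> \<circ> shift_map v = shift_map v \<circ> \<phi>"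
    then show "entropy_rate \<nu> s G \<le> entropy_rate \<mu> r F"
      by (intro entropy_rate_factor_le[OF \<mu> assms(2) \<nu>(2,3)]) (auto simp: fun_eq_iff)
  }
  fix \<phi> E E'
  assume iso: "isomorphism_on \<mu> F \<nu> G E E' \<phi>"
    and shift: "\<forall>v. intertwines_on E \<phi> (shift_map v) (shift_map v)"
  from isomorphism_on_factor_maps[OF assms(5,8) sp iso]
  obtain \<phi>' \<psi> where \<phi>': "\<And>x. x \<in> E \<Longrightarrow> \<phi>' x = \<phi> x" and E: "AE x in \<mu>. x \<in> E"
    and fac: "\<phi>' \<in> measurable \<mu> \<nu>" "distr \<mu> \<nu> \<phi>' = \<nu>"
    and fac': "\<psi> \<in> measurable \<nu> \<mu>" "distr \<nu> \<mu> \<psi> = \<mu>"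
    and left: "AE x in \<mu>. \<psi> (\<phi>' x) = x" and right: "AE y in \<nu>. \<phi>' (\<psi> y) = y"
    by blast
  have F: "invariant_under \<mu> F" and sh: "\<And>v. invariant_under \<mu> (shift_map v)"
    using assms(7) by (auto simp: bi_invariant_def)
  have comm: "AE x in \<mu>. \<phi>' (F x) = G (\<phi>' x)"
    using iso by (intro AE_intertwines_on[OF F E _ \<phi>']) (auto simp: isomorphism_on_def)
  have comm_shift: "AE x in \<mu>. \<phi>' (shift_map v x) = shift_map v (\<phi>' x)" for v
    by (rule AE_intertwines_on[OF sh E shift[rule_format] \<phi>'])
  show "entropy_rate \<mu> r F = entropy_rate \<nu> s G"
  proof (rule antisym)
    show "entropy_rate \<nu> s G \<le> entropy_rate \<mu> r F"
      by (rule entropy_rate_factor_le[OF \<mu> assms(2) \<nu>(2,3) fac comm comm_shift])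
    \<comment> \<open>The roles are exchanged: \<open>\<psi>\<close> is a factor map from
      \<open>\<nu>\<close> to \<open>\<mu>\<close>, and the relevant radius is \<open>s\<close>,
      that of \<open>G\<close>. Commutation of \<open>\<psi>\<close> with the automata and shifts is
      inherited from \<open>\<phi>'\<close>.\<close>
    show "entropy_rate \<mu> r F \<le> entropy_rate \<nu> s G"
      by (intro entropy_rate_factor_le[OF \<nu> assms(4) \<mu>(2,3) fac']
          AE_intertwines_inverse[where \<phi> = \<phi>' and \<psi> = \<psi>, OF right fac' _ left] F comm sh comm_shift)
  qed
qed

end
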